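(* Consider an $N$-way partitioned implicit-implicit GARK (IMIM-GARK) method whose coefficient blocks have the following special structure: there are $b^{D},c^{D}\in\mathbb{R}^{s}$ and $A^{D},A^{L},A^{U}\in\mathbb{R}^{s\times s}$, with $A^{U}$ strictly lower triangular and $A^{D},A^{L}$ lower triangular, such that for $q,m\in\{1,\dots,N\}$ $$A^{\{q,m\}}=\begin{cases}A^{L}, & m<q,\\ A^{D}, & m=q,\\ A^{U}, & m>q,\end{cases}\qquad b^{\{q\}}=b^{D},\qquad c^{\{q\}}=c^{D}.$$ Assume the method is internally consistent, i.e. $A^{D}\mathbf{1}_s=A^{L}\mathbf{1}_s=A^{U}\mathbf{1}_s=c^{D}$, where $\mathbf{1}_s\in\mathbb{R}^s$ is the vector of ones. Then: (i) The method has order $p\in\{1,2,3\}$ if and only if each component Runge--Kutta method $(A^{D},b^{D},c^{D})$, $(A^{L},b^{D},c^{D})$ and $(A^{U},b^{D},c^{D})$ has order at least $p$. (ii) The method has order $p=4$ if and only if each component Runge--Kutta method $(A^{D},b^{D},c^{D})$, $(A^{L},b^{D},c^{D})$ and $(A^{U},b^{D},c^{D})$ has order at least $4$ and, in addition, the following coupling order conditions are satisfied: $$(b^{D})^{T}A^{D}A^{U}c^{D}=\tfrac1{24},\qquad (b^{D})^{T}A^{U}A^{D}c^{D}=\tfrac1{24},$$ $$(b^{D})^{T}A^{L}A^{U}c^{D}=\tfrac1{24},\qquad (b^{D})^{T}A^{U}A^{L}c^{D}=\tfrac1{24},$$ $$(b^{D})^{T}A^{D}A^{L}c^{D}=\tfrac1{24},\qquad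 (b^{D})^{T}A^{L}A^{D}c^{D}=\tfrac1{24}.$$
   Context: GARK methods. Consider the additively partitioned initial value problem $y'=\sum_{m=1}^{N}f^{\{m\}}(t,y)$, $y(t_0)=y_0\in\mathbb{R}^d$, where $N$ is the number of partitions. An $N$-way partitioned general-structure additive Runge--Kutta (GARK) method with coefficients $A^{\{q,m\}}=(a^{\{q,m\}}_{i,j})\in\mathbb{R}^{s^{\{q\}}\times s^{\{m\}}}$ and $b^{\{q\}},c^{\{q\}}\in\mathbb{R}^{s^{\{q\}}}$ ($q,m=1,\dots,N$) and step size $h$ computes $$Y_i^{\{q\}}=y_n+h\sum_{m=1}^{N}\sum_{j=1}^{s^{\{m\}}}a^{\{q,m\}}_{i,j}\,f^{\{m\}}\big(t_n+c^{\{m\}}_jh,\,Y^{\{m\}}_j\big),\qquad i=1,\dots,s^{\{q\}},\ q=1,\dots,N,$$ $$y_{n+1}=y_n+h\sum_{q=1}^{N}\sum_{i=1}^{s^{\{q\}}}b^{\{q\}}_i\,f^{\{q\}}\big(t_n+c^{\{q\}}_ih,\,Y^{\{q\}}_i\big).$$ IMIM-GARK. Such a method is called implicit-implicit (IMIM-GARK) if simultaneously permuting the rows and columns of the full block matrix $A=[A^{\{q,m\}}]_{q,m=1}^N$ (i.e. reordering all stages) can make it lower triangular. In the claim all $s^{\{q\}}$ equal $s$, and the stated triangularity of $A^{D},A^{L},A^{U}$ gives this property. Internal consistency. In general it means $A^{\{q,1\}}\mathbf{1}=\cdots=A^{\{q,N\}}\mathbf{1}=c^{\{q\}}$ for every $q$.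 Order. The order of a GARK method up to four is characterized by the GARK order conditions. Write $c^{\{\sigma,\nu\}}:=A^{\{\sigma,\nu\}}\mathbf{1}$, assume $c^{\{\sigma\}}=c^{\{\sigma,\sigma\}}$, and let $\times$ denote the componentwise product of vectors. The method has order (at least) $p\le 4$ iff all conditions listed for orders $1,\dots,p$ hold for all $\sigma,\nu,\mu,\lambda\in\{1,\dots,N\}$: - Order 1: $b^{\{\sigma\}T}\mathbf{1}=1$. - Order 2: $b^{\{\sigma\}T}c^{\{\sigma,\nu\}}=\tfrac12$. - Order 3: $b^{\{\sigma\}T}(c^{\{\sigma,\nu\}}\times c^{\{\sigma,\mu\}})=\tfrac13$ and $b^{\{\sigma\}T}A^{\{\sigma,\nu\}}c^{\{\nu,\mu\}}=\tfrac16$. - Order 4: $b^{\{\sigma\}T}(c^{\{\sigma,\lambda\}}\times c^{\{\sigma,\mu\}}\times c^{\{\sigma,\nu\}})=\tfrac14$; $(b^{\{\sigma\}}\times c^{\{\sigma,\mu\}})^TA^{\{\sigma,\nu\}}c^{\{\nu,\lambda\}}=\tfrac18$; $b^{\{\sigma\}T}A^{\{\sigma,\lambda\}}(c^{\{\lambda,\mu\}}\times c^{\{\lambda,\nu\}})=\tfrac1{12}$; and $b^{\{\sigma\}T}A^{\{\sigma,\lambda\}}A^{\{\lambda,\nu\}}c^{\{\nu,\mu\}}=\tfrac1{24}$. The order of an ordinary Runge--Kutta method $(A,b,c)$ with $A\mathbf{1}=c$ is given by the case $N=1$ of these conditions (the classical Runge--Kutta order conditions).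
   Formalization: The "only if" in (i) is stated for N ≥ 2 and in (ii) for N ≥ 3, since as printed they fail for N = 1 (A^L, A^U do not occur) and for N = 2 at order 4 (products A^U A^U, A^L A^L do not occur); the "if" directions hold for every N. *)

theory Defs
  imports Complex_Main "Jordan_Normal_Form.Matrix"
begin

definition ones :: "nat \<Rightarrow> real vec" where
  "ones n = vec n (\<lambda>_. 1)"

definition hadamard :: "real vec \<Rightarrow> real vec \<Rightarrow> real vec"  (infixl \<open>\<odot>\<close> 75) where
  "v \<odot> w = vec (dim_vec v) (\<lambda>i. v $ i * w $ i)"

definition lower_triangular :: "real mat \<Rightarrow> bool" where
  "lower_triangular A \<longleftrightarrow> (\<forall>i < dim_row A. \<forall>j < dim_col A. i < j \<longrightarrow> A $$ (i, j) = 0)"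

definition strictly_lower_triangular :: "real mat \<Rightarrow> bool" where
  "strictly_lower_triangular A \<longleftrightarrow> (\<forall>i < dim_row A. \<forall>j < dim_col A. i \<le> j \<longrightarrow> A $$ (i, j) = 0)"

(* Coefficients of an N-way partitioned method, N = parts M. Partitions are numbered
   1, ..., N as usual, whereas vector and matrix entries are indexed from 0. Values of the
   fields at partition numbers outside {1..N} are irrelevant. *)
record gark =
  parts :: nat
  stages :: "nat \<Rightarrow> nat"
  coef_A :: "nat \<Rightarrow> nat \<Rightarrow> real mat"
  coef_b :: "nat \<Rightarrow> real vec"
  coef_c :: "nat \<Rightarrow> real vec"

definition gark_method :: "gark \<Rightarrow> bool" where
  "gark_method M \<longleftrightarrow> 1 \<le> parts M \<and>
     (\<forall>q\<in>{1..parts M}. coef_b M q \<in> carrier_vec (stages M q) \<and>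
        coef_c M q \<in> carrier_vec (stages M q) \<and>
        (\<forall>m\<in>{1..parts M}. coef_A M q m \<in> carrier_mat (stages M q) (stages M m)))"

(* The pair (q, i) is the i-th stage of partition q, i.e. one row and column of the full
   block matrix. *)
definition stage_set :: "gark \<Rightarrow> (nat \<times> nat) set" where
  "stage_set M = (SIGMA q:{1..parts M}. {..<stages M q})"

(* The map ord gives the position of each stage in the reordered block matrix. *)
definition imim_gark :: "gark \<Rightarrow> bool" where
  "imim_gark M \<longleftrightarrow> gark_method M \<and>
     (\<exists>ord. bij_betw ord (stage_set M) {..<card (stage_set M)} \<and>
        (\<forall>(q, i)\<in>stage_set M. \<forall>(m, j)\<in>stage_set M.
           ord (q, i) < ord (m, j) \<longrightarrow> coef_A M q m $$ (i, j) = 0))"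

definition abscissa :: "gark \<Rightarrow> nat \<Rightarrow> nat \<Rightarrow> real vec" where
  "abscissa M q m = coef_A M q m *\<^sub>v ones (stages M m)"

definition internally_consistent :: "gark \<Rightarrow> bool" where
  "internally_consistent M \<longleftrightarrow>
     (\<forall>q\<in>{1..parts M}. \<forall>m\<in>{1..parts M}. abscissa M q m = coef_c M q)"

(* The order conditions below are those of the methods with coef_c M q = abscissa M q q, so
   coef_c does not occur in them. *)
definition order_conditions_1 :: "gark \<Rightarrow> bool" where
  "order_conditions_1 M \<longleftrightarrow>
     (\<forall>\<sigma>\<in>{1..parts M}. coef_b M \<sigma> \<bullet> ones (stages M \<sigma>) = 1)"

definition order_conditions_2 :: "gark \<Rightarrow> bool" where
  "order_conditions_2 M \<longleftrightarrow>
     (\<forall>\<sigma>\<in>{1..parts M}. \<forall>\<nu>\<in>{1..parts M}. coef_b M \<sigma> \<bullet> abscissa M \<sigma> \<nu> = 1/2)"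

definition order_conditions_3 :: "gark \<Rightarrow> bool" where
  "order_conditions_3 M \<longleftrightarrow>
     (\<forall>\<sigma>\<in>{1..parts M}. \<forall>\<nu>\<in>{1..parts M}. \<forall>\<mu>\<in>{1..parts M}.
        coef_b M \<sigma> \<bullet> (abscissa M \<sigma> \<nu> \<odot> abscissa M \<sigma> \<mu>) = 1/3 \<and>
        coef_b M \<sigma> \<bullet> (coef_A M \<sigma> \<nu> *\<^sub>v abscissa M \<nu> \<mu>) = 1/6)"

definition order_conditions_4 :: "gark \<Rightarrow> bool" where
  "order_conditions_4 M \<longleftrightarrow>
     (\<forall>\<sigma>\<in>{1..parts M}. \<forall>\<nu>\<in>{1..parts M}. \<forall>\<mu>\<in>{1..parts M}. \<forall>\<kappa>\<in>{1..parts M}.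
        coef_b M \<sigma> \<bullet> (abscissa M \<sigma> \<kappa> \<odot> abscissa M \<sigma> \<mu> \<odot> abscissa M \<sigma> \<nu>) = 1/4 \<and>
        (coef_b M \<sigma> \<odot> abscissa M \<sigma> \<mu>) \<bullet> (coef_A M \<sigma> \<nu> *\<^sub>v abscissa M \<nu> \<kappa>) = 1/8 \<and>
        coef_b M \<sigma> \<bullet> (coef_A M \<sigma> \<kappa> *\<^sub>v (abscissa M \<kappa> \<mu> \<odot> abscissa M \<kappa> \<nu>)) = 1/12 \<and>
        coef_b M \<sigma> \<bullet> (coef_A M \<sigma> \<kappa> *\<^sub>v (coef_A M \<kappa> \<nu> *\<^sub>v abscissa M \<nu> \<mu>)) = 1/24)"

(* Order at least p. Conditions for orders above 4 are not considered. *)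
definition gark_order_ge :: "gark \<Rightarrow> nat \<Rightarrow> bool" where
  "gark_order_ge M p \<longleftrightarrow> p \<le> 4 \<and>
     (1 \<le> p \<longrightarrow> order_conditions_1 M) \<and> (2 \<le> p \<longrightarrow> order_conditions_2 M) \<and>
     (3 \<le> p \<longrightarrow> order_conditions_3 M) \<and> (4 \<le> p \<longrightarrow> order_conditions_4 M)"

definition rk_method :: "real mat \<Rightarrow> real vec \<Rightarrow> real vec \<Rightarrow> gark" where
  "rk_method A b c =
     \<lparr>parts = 1, stages = (\<lambda>_. dim_vec b),
      coef_A = (\<lambda>_ _. A), coef_b = (\<lambda>_. b), coef_c = (\<lambda>_. c)\<rparr>"

definition rk_order_ge :: "real mat \<Rightarrow> real vec \<Rightarrow> real vec \<Rightarrow> nat \<Rightarrow> bool" where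
  "rk_order_ge A b c p \<longleftrightarrow> gark_order_ge (rk_method A b c) p"

definition components_order_ge ::
  "real mat \<Rightarrow> real mat \<Rightarrow> real mat \<Rightarrow> real vec \<Rightarrow> real vec \<Rightarrow> nat \<Rightarrow> bool" where
  "components_order_ge AD AL AU b c p \<longleftrightarrow>
     rk_order_ge AD b c p \<and> rk_order_ge AL b c p \<and> rk_order_ge AU b c p"

definition coupling_conditions_4 ::
  "real mat \<Rightarrow> real mat \<Rightarrow> real mat \<Rightarrow> real vec \<Rightarrow> real vec \<Rightarrow> bool" where
  "coupling_conditions_4 AD AL AU b c \<longleftrightarrow>
     b \<bullet> (AD *\<^sub>v (AU *\<^sub>v c)) = 1/24 \<and> b \<bullet> (AU *\<^sub>v (AD *\<^sub>v c)) = 1/24 \<and>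
     b \<bullet> (AL *\<^sub>v (AU *\<^sub>v c)) = 1/24 \<and> b \<bullet> (AU *\<^sub>v (AL *\<^sub>v c)) = 1/24 \<and>
     b \<bullet> (AD *\<^sub>v (AL *\<^sub>v c)) = 1/24 \<and> b \<bullet> (AL *\<^sub>v (AD *\<^sub>v c)) = 1/24"

(* The triangularity of the three blocks suffices for the IMIM property: visit the first
   stages of all partitions in turn, then all second stages, and so on. *)
lemma imim_gark_if_triangular_blocks:
  assumes M: "gark_method M"
    and st: "\<forall>q\<in>{1..parts M}. stages M q = s"
    and dim: "AD \<in> carrier_mat s s" "AL \<in> carrier_mat s s" "AU \<in> carrier_mat s s"
    and tri: "strictly_lower_triangular AU" "lower_triangular AD" "lower_triangular AL"
    and blocks: "\<forall>q\<in>{1..parts M}. \<forall>m\<in>{1..parts M}.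
          coef_A M q m = (if m < q then AL else if m = q then AD else AU)"
  shows "imim_gark M"
proof -
  let ?N = "parts M"
  define ord where "ord = (\<lambda>(q, i). i * ?N + (q - 1))"
  have S: "stage_set M = {1..?N} \<times> {..<s}"
    using st unfolding stage_set_def by auto
  have card: "card (stage_set M) = s * ?N"
    unfolding S by simp
  have N: "?N > 0" using M unfolding gark_method_def by simp
  have "bij_betw ord (stage_set M) {..<card (stage_set M)}"
    unfolding card unfolding S
  proof (rule bij_betw_byWitness[where f' = "\<lambda>k. (k mod ?N + 1, k div ?N)"])
    show "\<forall>a\<in>{1..?N} \<times> {..<s}. (ord a mod ?N + 1, ord a div ?N) = a"
    proof
      fix a assume "a \<in> {1..?N} \<times> {..<s}"
      then obtain q i where a: "a = (q, i)" and "q \<in> {1..?N}" by auto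
      then obtain r where "q = Suc r" "r < ?N" by (cases q) auto
      then show "(ord a mod ?N + 1, ord a div ?N) = a"
        unfolding ord_def a by simp
    qed
    show "\<forall>k\<in>{..<s * ?N}. ord (k mod ?N + 1, k div ?N) = k"
      unfolding ord_def by auto
    show "ord ` ({1..?N} \<times> {..<s}) \<subseteq> {..<s * ?N}"
    proof
      fix k assume "k \<in> ord ` ({1..?N} \<times> {..<s})"
      then obtain q i where *: "q \<in> {1..?N}" "i < s" and k: "k = i * ?N + (q - 1)"
        unfolding ord_def by auto
      have "k < Suc i * ?N" using * unfolding k by auto
      also have "\<dots> \<le> s * ?N" using * by (intro mult_le_mono1) simp
      finally show "k \<in> {..<s * ?N}" by simp
    qed
    show "(\<lambda>k. (k mod ?N + 1, k div ?N)) ` {..<s * ?N} \<subseteq> {1..?N} \<times> {..<s}"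
      using N by (auto simp: less_mult_imp_div_less Suc_le_eq)
  qed
  moreover have "coef_A M q m $$ (i, j) = 0"
    if q: "q \<in> {1..?N}" and m: "m \<in> {1..?N}" and ij: "i < s" "j < s"
      and lt: "ord (q, i) < ord (m, j)" for q m i j
  proof -
    have le: "i \<le> j"
    proof (rule ccontr)
      assume "\<not> i \<le> j"
      then have "Suc j * ?N \<le> i * ?N" by (intro mult_le_mono1) simp
      then show False using lt q m unfolding ord_def by auto
    qed
    have "i < j" if "m \<le> q"
      using le lt that q m unfolding ord_def by (cases "i = j") auto
    then show ?thesis
      using q m ij le blocks tri dim
      unfolding lower_triangular_def strictly_lower_triangular_def by auto
  qed
  ultimately show ?thesis
    using M unfolding imim_gark_def S by (intro conjI exI[of _ ord]) auto
qed

end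

(* By internal consistency every abscissa vector equals cD, so a condition of order at most 4
   involves at most two blocks: one block, ranging over {AD, AL, AU}, or a product
   A^{sigma,kappa} A^{kappa,nu}. With two partitions every block occurs, at (1,1), (2,1) and
   (1,2). With three partitions all nine products occur, and those of two distinct blocks give
   the coupling conditions. *)
theory Submission
  imports Defs
begin

lemma gark_order_ge_iff:
  "gark_order_ge M 1 \<longleftrightarrow> order_conditions_1 M"
  "gark_order_ge M 2 \<longleftrightarrow> order_conditions_1 M \<and> order_conditions_2 M"
  "gark_order_ge M 3 \<longleftrightarrow> order_conditions_1 M \<and> order_conditions_2 M \<and> order_conditions_3 M"
  "gark_order_ge M 4 \<longleftrightarrow> order_conditions_1 M \<and> order_conditions_2 M \<and> order_conditions_3 M \<and>
    order_conditions_4 M"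
  by (simp_all add: gark_order_ge_def)

text \<open>There is a single partition and every abscissa is \<open>c\<close>. Together with
  \<open>gark_order_conditions\<close> this expresses both sides of the theorem through the same
  scalar equations; what remains is which blocks occur.\<close>

lemma rk_order_conditions:
  assumes "b \<in> carrier_vec s" "A *\<^sub>v ones s = c"
  shows "order_conditions_1 (rk_method A b c) \<longleftrightarrow> b \<bullet> ones s = 1"
    and "order_conditions_2 (rk_method A b c) \<longleftrightarrow> b \<bullet> c = 1/2"
    and "order_conditions_3 (rk_method A b c) \<longleftrightarrow>
      b \<bullet> (c \<odot> c) = 1/3 \<and> b \<bullet> (A *\<^sub>v c) = 1/6"
    and "order_conditions_4 (rk_method A b c) \<longleftrightarrow>
      b \<bullet> (c \<odot> c \<odot> c) = 1/4 \<and> (b \<odot> c) \<bullet> (A *\<^sub>v c) = 1/8 \<and>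
      b \<bullet> (A *\<^sub>v (c \<odot> c)) = 1/12 \<and> b \<bullet> (A *\<^sub>v (A *\<^sub>v c)) = 1/24"
  using assms
  by (simp_all add: order_conditions_1_def order_conditions_2_def order_conditions_3_def
      order_conditions_4_def abscissa_def rk_method_def)

text \<open>Indices that enter a condition only through an abscissa drop out; those that select a
  block stay. Only the 1/24 condition has two consecutive blocks, which share the middle index
  \<open>m\<close>.\<close>

lemma gark_order_conditions:
  assumes "gark_method M"
    and st: "\<forall>q\<in>{1..parts M}. stages M q = s"
    and b: "\<forall>q\<in>{1..parts M}. coef_b M q = b"
    and c: "\<forall>q\<in>{1..parts M}. coef_c M q = c"
    and ic: "internally_consistent M"
  shows "order_conditions_1 M \<longleftrightarrow> b \<bullet> ones s = 1"
    and "order_conditions_2 M \<longleftrightarrow> b \<bullet> c = 1/2"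
    and "order_conditions_3 M \<longleftrightarrow> b \<bullet> (c \<odot> c) = 1/3 \<and>
      (\<forall>q\<in>{1..parts M}. \<forall>m\<in>{1..parts M}. b \<bullet> (coef_A M q m *\<^sub>v c) = 1/6)"
    and "order_conditions_4 M \<longleftrightarrow> b \<bullet> (c \<odot> c \<odot> c) = 1/4 \<and>
      (\<forall>q\<in>{1..parts M}. \<forall>m\<in>{1..parts M}.
        (b \<odot> c) \<bullet> (coef_A M q m *\<^sub>v c) = 1/8 \<and>
        b \<bullet> (coef_A M q m *\<^sub>v (c \<odot> c)) = 1/12) \<and>
      (\<forall>q\<in>{1..parts M}. \<forall>m\<in>{1..parts M}. \<forall>k\<in>{1..parts M}.
        b \<bullet> (coef_A M q m *\<^sub>v (coef_A M m k *\<^sub>v c)) = 1/24)"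
proof -
  (* I hides the interval from simp, which would turn q : {1..N} into Suc 0 <= q. *)
  obtain I where I: "{1..parts M} = I" by blast
  \<comment> \<open>Quantifiers over indices that have dropped out can be removed because the range
    is nonempty.\<close>
  have one: "1 \<in> I"
    using assms(1) unfolding I[symmetric] by (simp add: gark_method_def)
  note st' = st[unfolded I] and b' = b[unfolded I]
  have ab: "abscissa M q m = c" if "q \<in> I" "m \<in> I" for q m
    using ic c that unfolding internally_consistent_def I by simp
  show "order_conditions_1 M \<longleftrightarrow> b \<bullet> ones s = 1"
    using one unfolding order_conditions_1_def I by (auto simp: st' b')
  show "order_conditions_2 M \<longleftrightarrow> b \<bullet> c = 1/2"
    using one unfolding order_conditions_2_def I by (auto simp: b' ab)
  show "order_conditions_3 M \<longleftrightarrow> b \<bullet> (c \<odot> c) = 1/3 \<and>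
      (\<forall>q\<in>{1..parts M}. \<forall>m\<in>{1..parts M}. b \<bullet> (coef_A M q m *\<^sub>v c) = 1/6)"
    using one unfolding order_conditions_3_def I by (auto simp: b' ab)
  show "order_conditions_4 M \<longleftrightarrow> b \<bullet> (c \<odot> c \<odot> c) = 1/4 \<and>
      (\<forall>q\<in>{1..parts M}. \<forall>m\<in>{1..parts M}.
        (b \<odot> c) \<bullet> (coef_A M q m *\<^sub>v c) = 1/8 \<and>
        b \<bullet> (coef_A M q m *\<^sub>v (c \<odot> c)) = 1/12) \<and>
      (\<forall>q\<in>{1..parts M}. \<forall>m\<in>{1..parts M}. \<forall>k\<in>{1..parts M}.
        b \<bullet> (coef_A M q m *\<^sub>v (coef_A M m k *\<^sub>v c)) = 1/24)"
    using one unfolding order_conditions_4_def I by (auto simp: b' ab)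
qed

text \<open>Necessity depends on \<open>N\<close>. For \<open>N = 1\<close> the conditions on
  \<open>M\<close> never mention \<open>AL\<close> and \<open>AU\<close>, nor does
  \<open>internally_consistent M\<close>, so their row sums are assumed separately. For
  \<open>N = 2\<close> the products \<open>AL AL\<close> and \<open>AU AU\<close> do not occur,
  since they take three distinct partitions.\<close>

theorem theorem1:
  fixes M :: gark and N s :: nat
    and AD AL AU :: "real mat" and bD cD :: "real vec"
  assumes imim: "imim_gark M"
    and N: "parts M = N"
    and dims: "AD \<in> carrier_mat s s" "AL \<in> carrier_mat s s" "AU \<in> carrier_mat s s"
      "bD \<in> carrier_vec s" "cD \<in> carrier_vec s"
    and triangular: "strictly_lower_triangular AU" "lower_triangular AD" "lower_triangular AL"
    and stages: "\<forall>q\<in>{1..N}. stages M q = s"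
    and A: "\<forall>q\<in>{1..N}. \<forall>m\<in>{1..N}.
          coef_A M q m = (if m < q then AL else if m = q then AD else AU)"
    and b: "\<forall>q\<in>{1..N}. coef_b M q = bD"
    and c: "\<forall>q\<in>{1..N}. coef_c M q = cD"
    and consistent: "internally_consistent M"
      "AD *\<^sub>v ones s = cD" "AL *\<^sub>v ones s = cD" "AU *\<^sub>v ones s = cD"
  shows
    "(2 \<le> N \<longrightarrow> (\<forall>p\<in>{1, 2, 3}.
        gark_order_ge M p \<longleftrightarrow> components_order_ge AD AL AU bD cD p)) \<and>
     (3 \<le> N \<longrightarrow>
        (gark_order_ge M 4 \<longleftrightarrow>
           components_order_ge AD AL AU bD cD 4 \<and> coupling_conditions_4 AD AL AU bD cD)) \<and>
     (\<forall>p\<in>{1, 2, 3}. components_order_ge AD AL AU bD cD p \<longrightarrow> gark_order_ge M p) \<and>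
     (components_order_ge AD AL AU bD cD 4 \<and> coupling_conditions_4 AD AL AU bD cD
        \<longrightarrow> gark_order_ge M 4)"
proof -
  have M: "gark_method M" using imim by (simp add: imim_gark_def)
  note gark = gark_order_conditions[OF M, unfolded N, OF stages b c consistent(1)]
  note rk = rk_order_conditions[OF dims(4)]
  note comp = components_order_ge_def rk_order_ge_def gark_order_ge_iff
    rk[OF consistent(2)] rk[OF consistent(3)] rk[OF consistent(4)]
  define B :: "nat \<Rightarrow> nat \<Rightarrow> real mat"
    where "B q m = (if m < q then AL else if m = q then AD else AU)" for q m
  have blocks: "coef_A M q m = B q m" if "q \<in> {1..N}" "m \<in> {1..N}" for q m
    using A that by (simp add: B_def)
  \<comment> \<open>No lower bound on \<open>N\<close>: whichever blocks occur are among the three.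
    This direction and \<open>double_if\<close> give sufficiency for every \<open>N\<close>.\<close>
  have single_if: "\<forall>q\<in>{1..N}. \<forall>m\<in>{1..N}. P (coef_A M q m)" if "P AD \<and> P AL \<and> P AU" for P
    using that by (simp add: blocks B_def)
  have single: "(\<forall>q\<in>{1..N}. \<forall>m\<in>{1..N}. P (coef_A M q m)) \<longleftrightarrow> P AD \<and> P AL \<and> P AU"
    if "2 \<le> N" for P
  proof
    assume *: "\<forall>q\<in>{1..N}. \<forall>m\<in>{1..N}. P (coef_A M q m)"
    have "P (B q m)" if "q \<in> {1..N}" "m \<in> {1..N}" for q m
      using * blocks that by metis
    from this[of 1 1] this[of 2 1] this[of 1 2] that
    show "P AD \<and> P AL \<and> P AU" by (simp add: B_def)
  qed (rule single_if)
  have double_if: "\<forall>q\<in>{1..N}. \<forall>m\<in>{1..N}. \<forall>k\<in>{1..N}. P (coef_A M q m) (coef_A M m k)"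
    if "P AD AD \<and> P AD AL \<and> P AD AU \<and> P AL AD \<and> P AL AL \<and> P AL AU \<and>
      P AU AD \<and> P AU AL \<and> P AU AU" for P
    using that by (simp add: blocks B_def)
  have double: "(\<forall>q\<in>{1..N}. \<forall>m\<in>{1..N}. \<forall>k\<in>{1..N}. P (coef_A M q m) (coef_A M m k)) \<longleftrightarrow>
      P AD AD \<and> P AD AL \<and> P AD AU \<and> P AL AD \<and> P AL AL \<and> P AL AU \<and>
      P AU AD \<and> P AU AL \<and> P AU AU" (is "?lhs \<longleftrightarrow> ?rhs")
    if "3 \<le> N" for P
  proof
    assume ?lhs
    have "P (B q m) (B m k)" if "q \<in> {1..N}" "m \<in> {1..N}" "k \<in> {1..N}" for q m k
      using \<open>?lhs\<close> blocks that by metis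
    \<comment> \<open>The chains follow the order of the products in \<open>?rhs\<close>: an equal
      step gives \<open>AD\<close>, a descent \<open>AL\<close>, an ascent \<open>AU\<close>.
      Partition 3 is used only for 3, 2, 1 (\<open>AL AL\<close>) and 1, 2, 3
      (\<open>AU AU\<close>).\<close>
    from this[of 1 1 1] this[of 2 2 1] this[of 1 1 2] this[of 2 1 1] this[of 3 2 1]
      this[of 2 1 2] this[of 1 2 2] this[of 1 2 1] this[of 1 2 3] that
    show ?rhs by (simp add: B_def)
  qed (rule double_if)
  let ?P3 = "\<lambda>X. bD \<bullet> (X *\<^sub>v cD) = 1/6"
  let ?P4 = "\<lambda>X. (bD \<odot> cD) \<bullet> (X *\<^sub>v cD) = 1/8 \<and> bD \<bullet> (X *\<^sub>v (cD \<odot> cD)) = 1/12"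
  let ?Q4 = "\<lambda>X Y. bD \<bullet> (X *\<^sub>v (Y *\<^sub>v cD)) = 1/24"
  have low: "\<forall>p\<in>{1, 2, 3}. gark_order_ge M p \<longleftrightarrow> components_order_ge AD AL AU bD cD p"
    if "2 \<le> N"
    unfolding ball_simps comp gark single[OF that, of ?P3] by blast
  have four: "gark_order_ge M 4 \<longleftrightarrow>
      components_order_ge AD AL AU bD cD 4 \<and> coupling_conditions_4 AD AL AU bD cD"
    if "3 \<le> N"
  proof -
    have "2 \<le> N" using that by simp
    show ?thesis
      \<comment> \<open>Of the nine products under \<open>?Q4\<close>, the three squares belong to
        the component methods and the six mixed ones are the coupling conditions; the rest is
        propositional.\<close>
      unfolding comp gark coupling_conditions_4_def single[OF \<open>2 \<le> N\<close>, of ?P3]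
        single[OF \<open>2 \<le> N\<close>, of ?P4] double[OF that, of ?Q4]
      by blast
  qed
  have suff3: "\<forall>p\<in>{1, 2, 3}. components_order_ge AD AL AU bD cD p \<longrightarrow> gark_order_ge M p"
    using single_if[of ?P3] unfolding ball_simps comp gark by blast
  have suff4: "gark_order_ge M 4"
    if "components_order_ge AD AL AU bD cD 4 \<and> coupling_conditions_4 AD AL AU bD cD"
    using that unfolding comp gark coupling_conditions_4_def
    by (intro conjI single_if[of ?P3] single_if[of ?P4] double_if[of ?Q4]) blast+
  show ?thesis
    by (intro conjI impI low four suff3; (assumption | rule suff4))
qed

end
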